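(* Let $\epsilon>0$ and let $\alpha,\beta\in[0,1]$ satisfy $$\max\{\alpha,\beta\}<\frac12.$$ Let $\rho\in H^1([0,1])$ be the unique weak solution of $$-\epsilon\,\partial_{xx}\rho+\partial_x(\rho(1-\rho))=0\quad\text{in }(0,1),$$ with boundary conditions $$\epsilon\,\partial_x\rho=(1-\rho)(\rho-\alpha)\ \text{ at }x=0,\qquad \epsilon\,\partial_x\rho=\rho(1-\rho-\beta)\ \text{ at }x=1.$$ Then, if $\alpha<\beta$, $$\int_0^1|\rho-\alpha|\,dx\le\epsilon\,\frac{1-\alpha-\beta}{\beta-\alpha},$$ while, if $\alpha>\beta$, $$\int_0^1|\rho-1+\beta|\,dx\le\epsilon\,\frac{1-\alpha-\beta}{\alpha-\beta}.$$
   Context: A weak solution is a function $\rho\in H^1((0,1))$ such that for all $\varphi\in H^1((0,1))$ $$\int_0^1\big(\epsilon\,\partial_x\rho-\rho(1-\rho)\big)\partial_x\varphi\,dx-\alpha(1-\rho(0))\varphi(0)+\beta\rho(1)\varphi(1)=0.$$ The weak solution exists and is unique whenever $\alpha,\beta\in[0,1]$ are not both zero (in particular whenever $\alpha\neq\beta$). *)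

theory Defs
  imports "HOL-Analysis.Analysis"
begin

abbreviation unit_meas :: "real measure" where
  "unit_meas \<equiv> lebesgue_on {0<..<1}"

text \<open>Members of \<open>L2\<close> and \<open>H1\<close> are arbitrary representatives: only their values on
  \<open>(0,1)\<close>, up to null sets, matter.\<close>

definition L2 :: "(real \<Rightarrow> real) set" where
  "L2 = {u. u \<in> borel_measurable unit_meas \<and> integrable unit_meas (\<lambda>x. (u x)\<^sup>2)}"

definition test_fun :: "(real \<Rightarrow> real) \<Rightarrow> bool" where
  "test_fun \<phi> \<longleftrightarrow>
     (\<forall>n x. (deriv ^^ n) \<phi> differentiable (at x)) \<and> closure {x. \<phi> x \<noteq> 0} \<subseteq> {0<..<1}"

definition is_weak_deriv :: "(real \<Rightarrow> real) \<Rightarrow> (real \<Rightarrow> real) \<Rightarrow> bool" where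
  "is_weak_deriv u g \<longleftrightarrow>
     (\<forall>\<phi>. test_fun \<phi> \<longrightarrow>
        (\<integral>x. u x * deriv \<phi> x \<partial>unit_meas) = - (\<integral>x. g x * \<phi> x \<partial>unit_meas))"

definition H1 :: "(real \<Rightarrow> real) set" where
  "H1 = {u \<in> L2. \<exists>g\<in>L2. is_weak_deriv u g}"

text \<open>For \<open>u \<in> H1\<close> the weak derivative is determined up to a null set, and the continuous
  representative is determined on \<open>[0,1]\<close>, including the endpoints (it exists by the
  one-dimensional Sobolev embedding). The choice operators below are therefore harmless.
  The boundary value \<open>u(p)\<close>, \<open>p \<in> {0,1}\<close>, of \<open>u \<in> H1\<close> is \<open>cont_rep u p\<close>.\<close>

definition weak_deriv :: "(real \<Rightarrow> real) \<Rightarrow> real \<Rightarrow> real" where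
  "weak_deriv u = (SOME g. g \<in> L2 \<and> is_weak_deriv u g)"

definition cont_rep :: "(real \<Rightarrow> real) \<Rightarrow> real \<Rightarrow> real" where
  "cont_rep u = (SOME v. continuous_on {0..1} v \<and> (AE x in unit_meas. u x = v x))"

text \<open>Weak form of \<open>- \<epsilon> \<rho>'' + (\<rho> (1 - \<rho>))' = 0\<close> with \<open>\<epsilon> \<rho>' = (1 - \<rho>) (\<rho> - \<alpha>)\<close> at \<open>0\<close> and
  \<open>\<epsilon> \<rho>' = \<rho> (1 - \<rho> - \<beta>)\<close> at \<open>1\<close>: these boundary conditions say that the flux
  \<open>\<epsilon> \<rho>' - \<rho> (1 - \<rho>)\<close> equals \<open>- \<alpha> (1 - \<rho>)\<close> at \<open>0\<close> and \<open>- \<beta> \<rho>\<close> at \<open>1\<close>.\<close>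

definition weak_solution :: "real \<Rightarrow> real \<Rightarrow> real \<Rightarrow> (real \<Rightarrow> real) \<Rightarrow> bool" where
  "weak_solution \<epsilon> \<alpha> \<beta> \<rho> \<longleftrightarrow> \<rho> \<in> H1 \<and>
     (\<forall>\<phi>\<in>H1.
        (\<integral>x. (\<epsilon> * weak_deriv \<rho> x - \<rho> x * (1 - \<rho> x)) * weak_deriv \<phi> x \<partial>unit_meas)
        - \<alpha> * (1 - cont_rep \<rho> 0) * cont_rep \<phi> 0
        + \<beta> * cont_rep \<rho> 1 * cont_rep \<phi> 1 = 0)"

end

theory Submission
  imports Defs
begin

text \<open>Testing the weak equation with smooth functions shows that the flux is constant, so the
  continuous representative \<open>v\<close> of the solution satisfies the autonomous equation
  \<open>\<epsilon> v' = v (1 - v) - J\<close> on \<open>[0,1]\<close> with \<open>J = \<alpha> (1 - v 0) = \<beta> v 1\<close>. Its right-hand side \<open>w\<close>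
  solves a linear homogeneous equation, hence has constant sign, and \<open>v\<close> is monotone. If
  \<open>\<alpha> < \<beta>\<close>, the boundary conditions exclude a decreasing \<open>v\<close> and force
  \<open>\<alpha> \<le> v \<le> 1 - \<beta>\<close>. Then \<open>J \<le> \<alpha> (1 - \<alpha>)\<close> yields
  \<open>\<epsilon> v' \<ge> (v - \<alpha>) (1 - v - \<alpha>) \<ge> (v - \<alpha>) (\<beta> - \<alpha>)\<close>, and integrating over \<open>[0,1]\<close> gives the
  bound. The case \<open>\<alpha> > \<beta>\<close> follows by the particle-hole symmetry \<open>x \<mapsto> 1 - v (1 - x)\<close>, which
  exchanges \<open>\<alpha>\<close> and \<open>\<beta>\<close>.\<close>

section \<open>Smooth bump functions\<close>

definition smooth :: "(real \<Rightarrow> real) \<Rightarrow> bool" where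
  "smooth f \<longleftrightarrow> (\<forall>n x. (deriv ^^ n) f differentiable (at x))"

lemma smooth_antiderivI:
  assumes "\<And>x. (f has_real_derivative f' x) (at x)" "smooth f'"
  shows "smooth f"
proof -
  have d: "deriv f = f'"
    using assms(1) DERIV_imp_deriv by blast
  show ?thesis
    unfolding smooth_def
  proof (intro allI)
    fix n x
    show "(deriv ^^ n) f differentiable (at x)"
    proof (cases n)
      case 0
      then show ?thesis
        using assms(1) real_differentiable_def by auto
    next
      case (Suc m)
      then show ?thesis
        using assms(2) by (simp add: smooth_def funpow_swap1 d del: funpow.simps(2) add: funpow_Suc_right)
    qed
  qed
qed

text \<open>By induction every iterate of \<open>deriv\<close> applied to \<open>f\<close> stays in
  \<open>C\<close>, so a class closed under differentiation certifies smoothness without computing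
  higher derivatives.\<close>

lemma smooth_coinduct:
  assumes "f \<in> C"
    and "\<And>g. g \<in> C \<Longrightarrow> \<exists>g'\<in>C. \<forall>x. (g has_real_derivative g' x) (at x)"
  shows "smooth f"
proof -
  have "(deriv ^^ n) f \<in> C" for n
  proof (induction n)
    case (Suc n)
    obtain g' where "g' \<in> C" "\<forall>x. ((deriv ^^ n) f has_real_derivative g' x) (at x)"
      using assms(2)[OF Suc] by blast
    moreover from this have "deriv ((deriv ^^ n) f) = g'"
      using DERIV_imp_deriv by blast
    ultimately show ?case by simp
  qed (use assms(1) in simp)
  then show ?thesis
    unfolding smooth_def using assms(2) real_differentiable_def by blast
qed

lemma smooth_derivE:
  assumes "smooth f"
  shows "(f has_real_derivative deriv f x) (at x)" "smooth (deriv f)"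
proof -
  have "(deriv ^^ 0) f differentiable (at x)"
    using assms unfolding smooth_def by blast
  then show "(f has_real_derivative deriv f x) (at x)"
    by (simp add: DERIV_deriv_iff_real_differentiable)
  show "smooth (deriv f)"
    using assms unfolding smooth_def by (metis comp_apply funpow_Suc_right)
qed

lemma smooth_const: "smooth (\<lambda>x. c)"
proof (rule smooth_coinduct[where C = "range (\<lambda>c x. c)"])
  fix g :: "real \<Rightarrow> real" assume "g \<in> range (\<lambda>c x. c)"
  then show "\<exists>g'\<in>range (\<lambda>c x. c). \<forall>x. (g has_real_derivative g' x) (at x)"
    by (intro bexI[of _ "\<lambda>x. 0"]) auto
qed auto

section \<open>Functions vanishing to infinite order at the origin\<close>

text \<open>The classical function exp(-1/x), extended by 0, with a polynomial factor in 1/x; the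
  factor is carried along because differentiation produces one.\<close>

definition flat :: "real poly \<Rightarrow> real \<Rightarrow> real" where
  "flat p x = (if 0 < x then poly p (1 / x) * exp (- (1 / x)) else 0)"

lemma poly_exp_tendsto_0:
  fixes p :: "real poly"
  shows "((\<lambda>x. poly p x * exp (- x)) \<longlongrightarrow> 0) at_top"
proof -
  have "((\<lambda>x. \<Sum>i\<le>degree p. coeff p i * (x ^ i / exp x)) \<longlongrightarrow> (\<Sum>i\<le>degree p. coeff p i * 0)) at_top"
    by (intro tendsto_intros tendsto_power_div_exp_0)
  then show ?thesis
    by (simp add: poly_altdef exp_minus field_simps sum_distrib_left sum_distrib_right sum_divide_distrib)
qed

lemma flat_tendsto_0: "(flat p \<longlongrightarrow> 0) (at_right 0)"
proof -
  have "((\<lambda>x. poly p (1 / x) * exp (- (1 / x))) \<longlongrightarrow> 0) (at_right 0)"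
    by (rule filterlim_compose[OF poly_exp_tendsto_0])
       (simp add: filterlim_inverse_at_top_right inverse_eq_divide[symmetric])
  then show ?thesis
    by (rule Lim_transform_eventually) (auto simp: flat_def eventually_at_filter)
qed

text \<open>With y = 1/x the inner derivative is -y^2, and p(y) exp(-y) has derivative (p' - p)(y)
  exp(-y) in y; the product has the polynomial y^2 (p - p'). The origin is treated by one-sided
  difference quotients.\<close>

lemma flat_has_derivative:
  "(flat p has_real_derivative flat (monom 1 2 * (p - pderiv p)) x) (at x)"
proof -
  consider "x < 0" | "x = 0" | "x > 0" by linarith
  then show ?thesis
  proof cases
    case 1
    have "((\<lambda>x. 0) has_real_derivative 0) (at x)" by simp
    then have "(flat p has_real_derivative 0) (at x)"
      by (rule has_field_derivative_transform_within_open[where S = "{..<0}"])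
         (use 1 in \<open>auto simp: flat_def\<close>)
    then show ?thesis using 1 by (simp add: flat_def)
  next
    case 3
    have "((\<lambda>x. poly p (1 / x) * exp (- (1 / x))) has_real_derivative
        flat (monom 1 2 * (p - pderiv p)) x) (at x)"
      using 3
      by (auto intro!: derivative_eq_intros DERIV_chain2[OF poly_DERIV]
          simp: flat_def poly_monom field_simps power2_eq_square)
    then show ?thesis
      by (rule has_field_derivative_transform_within_open[where S = "{0<..}"])
         (use 3 in \<open>auto simp: flat_def\<close>)
  next
    case 2
    have "((\<lambda>h. (flat p (0 + h) - flat p 0) / h) \<longlongrightarrow> 0) (at_left 0)"
      by (rule Lim_transform_eventually[OF tendsto_const])
         (auto simp: flat_def eventually_at_filter)
    \<comment> \<open>For h > 0, division by h multiplies the polynomial by its variable, so the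
      difference quotient is again a flat function.\<close>
    moreover have "((\<lambda>h. (flat p (0 + h) - flat p 0) / h) \<longlongrightarrow> 0) (at_right 0)"
      by (rule Lim_transform_eventually[OF flat_tendsto_0[of "monom 1 1 * p"]])
         (auto simp: flat_def eventually_at_filter poly_monom)
    ultimately have "((\<lambda>h. (flat p (0 + h) - flat p 0) / h) \<longlongrightarrow> 0) (at 0)"
      using filterlim_split_at_real by blast
    then show ?thesis
      using 2 by (simp add: DERIV_def flat_def)
  qed
qed

text \<open>Closed under differentiation, so all its members are smooth.\<close>

inductive_set flat_algebra :: "(real \<Rightarrow> real) set" where
  flat: "(\<lambda>x. flat p (m * x + b)) \<in> flat_algebra"
| add: "f \<in> flat_algebra \<Longrightarrow> g \<in> flat_algebra \<Longrightarrow> (\<lambda>x. f x + g x) \<in> flat_algebra"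
| mult: "f \<in> flat_algebra \<Longrightarrow> g \<in> flat_algebra \<Longrightarrow> (\<lambda>x. f x * g x) \<in> flat_algebra"

lemma flat_algebra_derivative:
  assumes "f \<in> flat_algebra"
  shows "\<exists>f'\<in>flat_algebra. \<forall>x. (f has_real_derivative f' x) (at x)"
  using assms
proof induction
  case (flat p m b)
  have "((\<lambda>x. flat p (m * x + b)) has_real_derivative
      flat (smult m (monom 1 2 * (p - pderiv p))) (m * x + b)) (at x)" for x
    by (rule DERIV_chain2[OF flat_has_derivative, THEN DERIV_cong])
       (auto intro!: derivative_eq_intros simp: flat_def)
  then show ?case using flat_algebra.flat[of _ m b] by (intro bexI) auto
next
  case (add f g)
  then obtain f' g' where "f' \<in> flat_algebra" "g' \<in> flat_algebra"
    "\<forall>x. (f has_real_derivative f' x) (at x)" "\<forall>x. (g has_real_derivative g' x) (at x)" by blast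
  then show ?case
    by (intro bexI[of _ "\<lambda>x. f' x + g' x"]) (auto intro: DERIV_add flat_algebra.add)
next
  case (mult f g)
  then obtain f' g' where "f' \<in> flat_algebra" "g' \<in> flat_algebra"
    "\<forall>x. (f has_real_derivative f' x) (at x)" "\<forall>x. (g has_real_derivative g' x) (at x)" by blast
  then show ?case using mult.hyps
    by (intro bexI[of _ "\<lambda>x. f' x * g x + g' x * f x"])
       (auto intro!: DERIV_mult flat_algebra.add flat_algebra.mult)
qed

lemma flat_algebra_smooth: "f \<in> flat_algebra \<Longrightarrow> smooth f"
  by (rule smooth_coinduct[OF _ flat_algebra_derivative])

text \<open>One factor vanishes left of \<open>a\<close>, the other right of \<open>b\<close>. The
  slope \<open>Suc n\<close> drives both exponents to 0 at interior points, so the bumps approximate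
  the indicator of the open interval. The affine arguments have the shape of the generators of
  \<open>flat_algebra\<close>.\<close>

definition bump :: "real \<Rightarrow> real \<Rightarrow> nat \<Rightarrow> real \<Rightarrow> real" where
  "bump a b n x = flat 1 (real (Suc n) * x + - real (Suc n) * a) * flat 1 (- real (Suc n) * x + real (Suc n) * b)"

lemma smooth_bump: "smooth (bump a b n)"
  unfolding bump_def
  by (intro flat_algebra_smooth flat_algebra.mult flat_algebra.flat)

lemma bump_eq:
  "bump a b n x = (if a < x \<and> x < b
     then exp (- (1 / (real (Suc n) * (x - a)))) * exp (- (1 / (real (Suc n) * (b - x)))) else 0)"
proof -
  have *: "real (Suc n) * x + - real (Suc n) * a = real (Suc n) * (x - a)" "- real (Suc n) * x + real (Suc n) * b = real (Suc n) * (b - x)"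
    by (simp_all add: algebra_simps)
  show ?thesis
    unfolding bump_def * by (simp add: flat_def zero_less_mult_iff)
qed

lemma bump_bounds: "0 \<le> bump a b n x" "bump a b n x \<le> 1"
proof -
  have "flat 1 y \<le> 1" "0 \<le> flat 1 y" for y
    by (auto simp: flat_def)
  then show "0 \<le> bump a b n x" "bump a b n x \<le> 1"
    by (simp_all add: bump_def mult_le_one)
qed

lemma bump_tendsto: "(\<lambda>n. bump a b n x) \<longlonglongrightarrow> indicator {a<..<b} x"
proof (cases "a < x \<and> x < b")
  case True
  have "(\<lambda>n. 1 / (real (Suc n) * c)) \<longlonglongrightarrow> 0" for c
    using tendsto_divide[OF LIMSEQ_Suc[OF lim_1_over_n] tendsto_const[of "c"]]
    by (cases "c = 0") auto
  then have "(\<lambda>n. exp (- (1 / (real (Suc n) * (x - a)))) * exp (- (1 / (real (Suc n) * (b - x)))))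
      \<longlonglongrightarrow> exp (- 0) * exp (- 0)"
    by (intro tendsto_intros)
  with True show ?thesis by (simp add: bump_eq)
qed (auto simp: bump_eq)

section \<open>Test functions supported in the open unit interval\<close>

lemma test_fun_iff: "test_fun \<phi> \<longleftrightarrow> smooth \<phi> \<and> closure {x. \<phi> x \<noteq> 0} \<subseteq> {0<..<1}"
  by (simp add: test_fun_def smooth_def)

lemma test_funI:
  assumes "smooth \<phi>" "0 < a" "b < 1" "\<And>x. x \<notin> {a..b} \<Longrightarrow> \<phi> x = 0"
  shows "test_fun \<phi>"
proof -
  have "closure {x. \<phi> x \<noteq> 0} \<subseteq> {a..b}"
    by (rule closure_minimal) (use assms(4) in blast, simp)
  then show ?thesis
    using assms unfolding test_fun_iff by fastforce
qed

lemma test_fun_bump: "0 < a \<Longrightarrow> b < 1 \<Longrightarrow> test_fun (bump a b n)"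
  by (rule test_funI[OF smooth_bump]) (auto simp: bump_eq)

section \<open>The fundamental lemma of the calculus of variations\<close>

interpretation unit: finite_measure unit_meas
  by (rule finite_measure_lebesgue_on) simp

lemma measure_unit [simp]: "measure unit_meas {0<..<1} = 1"
  by (subst measure_restrict_space) auto

section \<open>Measurability and integrability on the unit interval\<close>

lemma continuous_measurable_unit:
  fixes f :: "real \<Rightarrow> real"
  assumes "continuous_on {0<..<1} f"
  shows "f \<in> borel_measurable unit_meas"
  by (rule continuous_imp_measurable_on_sets_lebesgue[OF assms]) auto

lemma bounded_integrable_unit:
  fixes f :: "real \<Rightarrow> real"
  assumes "f \<in> borel_measurable unit_meas" "\<And>x. x \<in> {0<..<1} \<Longrightarrow> \<bar>f x\<bar> \<le> B"
  shows "integrable unit_meas f"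
  by (rule unit.integrable_const_bound[where B = B]) (use assms in auto)

lemma integrable_mult_bounded:
  fixes f h :: "real \<Rightarrow> real"
  assumes "integrable unit_meas f" "h \<in> borel_measurable unit_meas"
    "\<And>x. x \<in> {0<..<1} \<Longrightarrow> \<bar>h x\<bar> \<le> B"
  shows "integrable unit_meas (\<lambda>x. f x * h x)"
proof (rule Bochner_Integration.integrable_bound)
  show "integrable unit_meas (\<lambda>x. B * f x)" using assms by simp
  show "(\<lambda>x. f x * h x) \<in> borel_measurable unit_meas"
    using assms by (intro borel_measurable_times) auto
  show "AE x in unit_meas. norm (f x * h x) \<le> norm (B * f x)"
  proof (rule AE_I2)
    fix x assume "x \<in> space unit_meas"
    then have "\<bar>h x\<bar> \<le> \<bar>B\<bar>" using assms(3)[of x] by auto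
    then show "norm (f x * h x) \<le> norm (B * f x)"
      using mult_left_mono[of "\<bar>h x\<bar>" "\<bar>B\<bar>" "\<bar>f x\<bar>"] by (simp add: abs_mult mult.commute)
  qed
qed

lemma continuous_bounded_unit:
  fixes h :: "real \<Rightarrow> real"
  assumes "continuous_on {0..1} h"
  obtains B where "\<And>x. x \<in> {0<..<1} \<Longrightarrow> \<bar>h x\<bar> \<le> B"
proof -
  have "bounded (h ` {0..1})"
    using assms compact_continuous_image compact_imp_bounded by blast
  then obtain B where "\<forall>y\<in>h ` {0..1}. norm y \<le> B"
    unfolding bounded_iff by blast
  then show ?thesis by (intro that[of B]) auto
qed

lemma continuous_integrable_unit:
  fixes h :: "real \<Rightarrow> real"
  assumes "continuous_on {0..1} h"
  shows "integrable unit_meas h" "h \<in> borel_measurable unit_meas"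
proof -
  show m: "h \<in> borel_measurable unit_meas"
    by (rule continuous_measurable_unit) (rule continuous_on_subset[OF assms], auto)
  obtain B where "\<And>x. x \<in> {0<..<1} \<Longrightarrow> \<bar>h x\<bar> \<le> B"
    using continuous_bounded_unit[OF assms] by blast
  then show "integrable unit_meas h" by (rule bounded_integrable_unit[OF m])
qed

lemma integrable_mult_continuous:
  fixes f h :: "real \<Rightarrow> real"
  assumes "integrable unit_meas f" "continuous_on {0..1} h"
  shows "integrable unit_meas (\<lambda>x. f x * h x)"
  using continuous_bounded_unit[OF assms(2)] integrable_mult_bounded[OF assms(1)]
    continuous_integrable_unit(2)[OF assms(2)] by metis

lemma smooth_continuous_on: "smooth f \<Longrightarrow> continuous_on S f"
  using smooth_derivE(1) by (meson DERIV_isCont continuous_at_imp_continuous_on)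

text \<open>Bumps lie between 0 and 1 and converge pointwise to the indicator, so dominated
  convergence with majorant \<open>\<bar>f x\<bar>\<close> passes to the limit in the
  hypothesis.\<close>

lemma interval_integral_zero:
  fixes f :: "real \<Rightarrow> real"
  assumes "integrable unit_meas f"
    and "\<And>a b n. 0 < a \<Longrightarrow> a < b \<Longrightarrow> b < 1 \<Longrightarrow> (\<integral>x. f x * bump a b n x \<partial>unit_meas) = 0"
    and "0 < a" "a < b" "b < 1"
  shows "(\<integral>x. f x * indicator {a<..<b} x \<partial>unit_meas) = 0"
proof -
  have "(\<lambda>n. \<integral>x. f x * bump a b n x \<partial>unit_meas) \<longlonglongrightarrow>
      (\<integral>x. f x * indicator {a<..<b} x \<partial>unit_meas)"
  proof (rule integral_dominated_convergence)
    show "integrable unit_meas (\<lambda>x. \<bar>f x\<bar>)" using assms(1) by simp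
    show "AE x in unit_meas. (\<lambda>n. f x * bump a b n x) \<longlonglongrightarrow> f x * indicator {a<..<b} x"
      by (intro AE_I2 tendsto_intros bump_tendsto)
    show "AE x in unit_meas. norm (f x * bump a b n x) \<le> \<bar>f x\<bar>" for n
      by (auto simp: abs_mult bump_bounds intro!: mult_left_le)
    show "(\<lambda>x. f x * bump a b n x) \<in> borel_measurable unit_meas" for n
      using assms(1) continuous_integrable_unit(2)[OF smooth_continuous_on[OF smooth_bump]]
      by (intro borel_measurable_times) auto
    have "indicator {a<..<b} \<in> borel_measurable unit_meas"
      by (intro measurable_restrict_space1 measurable_completion) simp
    then show "(\<lambda>x. f x * indicator {a<..<b} x) \<in> borel_measurable unit_meas"
      using assms(1) by (intro borel_measurable_times) auto
  qed
  moreover have "(\<lambda>n. \<integral>x. f x * bump a b n x \<partial>unit_meas) = (\<lambda>n. 0)"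
    using assms by blast
  ultimately show ?thesis
    using LIMSEQ_unique tendsto_const by metis
qed

text \<open>Provides the intersection-stable generator for a pi-lambda argument.\<close>

lemma borel_Ioo: "sets borel = sigma_sets UNIV (range (\<lambda>(a, b). {a<..<b::real}))"
proof -
  have eq: "(\<lambda>(a, b). box a (b::real)) = (\<lambda>(a, b). {a<..<b})"
    by (auto simp: fun_eq_iff)
  show ?thesis
    unfolding borel_eq_box eq by (rule sets_measure_of) simp
qed

text \<open>Vanishing integrals are extended in stages: from bumps to intervals with closure in
  (0,1), then to all open intervals, to Borel sets and to Lebesgue sets, after which the density
  criterion applies.\<close>

lemma fundamental_lemma:
  fixes f :: "real \<Rightarrow> real"
  assumes f: "integrable unit_meas f"
    and "\<And>a b n. 0 < a \<Longrightarrow> a < b \<Longrightarrow> b < 1 \<Longrightarrow> (\<integral>x. f x * bump a b n x \<partial>unit_meas) = 0"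
  shows "AE x in unit_meas. f x = 0"
proof (rule unit.density_zero[OF f])
  have ind: "indicator A \<in> borel_measurable unit_meas" if "A \<in> sets borel" for A :: "real set"
    by (intro measurable_restrict_space1 measurable_completion) (use that in simp)
  have fA: "integrable unit_meas (\<lambda>x. f x * indicator A x)" if "A \<in> sets borel" for A
    by (rule integrable_mult_bounded[OF f ind[OF that], of 1]) (auto simp: indicator_def)
  have open_box: "(\<integral>x. f x * indicator {a<..<b} x \<partial>unit_meas) = 0" if ab: "a < b" "{a<..<b} \<inter> {0<..<1} \<noteq> {}" for a b :: real
  proof -
    define a' b' where "a' = max a 0" and "b' = min b 1"
    have ab': "0 \<le> a'" "a' < b'" "b' \<le> 1" using ab by (auto simp: a'_def b'_def)
    \<comment> \<open>The offset 3 keeps \<open>d n\<close> within a third of the length, so that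
      \<open>l n < r n\<close> holds from the first term on.\<close>
    define d where "d n = (b' - a') / real (n + 3)" for n
    define l r where "l n = a' + d n" and "r n = b' - d n" for n
    have d3: "d n \<le> (b' - a') / 3" and d0: "d n > 0" for n
      using ab' unfolding d_def by (intro divide_left_mono, auto)
    have d3': "3 * d n \<le> b' - a'" for n
      using d3[of n] by simp
    have lr: "0 < l n" "l n < r n" "r n < 1" for n
      unfolding l_def r_def using d3'[of n] d0[of n] ab' by simp_all
    have lim: "d \<longlonglongrightarrow> 0"
      unfolding d_def by (rule LIMSEQ_ignore_initial_segment[OF lim_const_over_n])
    have "(\<lambda>n. l n) \<longlonglongrightarrow> a' + 0" "(\<lambda>n. r n) \<longlonglongrightarrow> b' - 0"
      unfolding l_def r_def by (intro tendsto_intros lim)+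
    then have lims: "l \<longlonglongrightarrow> a'" "r \<longlonglongrightarrow> b'" by auto
    have "(\<lambda>n. \<integral>x. f x * indicator {l n<..<r n} x \<partial>unit_meas) \<longlonglongrightarrow>
      (\<integral>x. f x * indicator {a<..<b} x \<partial>unit_meas)"
    proof (rule integral_dominated_convergence)
      show "integrable unit_meas (\<lambda>x. \<bar>f x\<bar>)" using f by simp
      show "AE x in unit_meas. (\<lambda>n. f x * indicator {l n<..<r n} x) \<longlonglongrightarrow> f x * indicator {a<..<b} x"
      proof (intro AE_I2 tendsto_intros)
        fix x assume x: "x \<in> space unit_meas"
        show "(\<lambda>n. indicator {l n<..<r n} x) \<longlonglongrightarrow> (indicator {a<..<b} x :: real)"
        proof (cases "a < x \<and> x < b")
          case True
          then have "a' < x" "x < b'" using x by (auto simp: a'_def b'_def)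
          then have "eventually (\<lambda>n. l n < x \<and> x < r n) sequentially"
            using order_tendstoD[OF lims(1)] order_tendstoD[OF lims(2)] by (auto intro: eventually_conj)
          then have "eventually (\<lambda>n. indicator {l n<..<r n} x = (indicator {a<..<b} x :: real)) sequentially"
            by eventually_elim (use True in auto)
          then show ?thesis by (rule tendsto_eventually)
        next
          case False
          have "a' < l n" "r n < b'" for n using d0 unfolding l_def r_def by auto
          moreover have "\<not> (a' < x \<and> x < b')"
            using False by (auto simp: a'_def b'_def)
          ultimately have "\<not> (l n < x \<and> x < r n)" for n
            by (meson less_trans)
          then show ?thesis using False by simp
        qed
      qed
      show "AE x in unit_meas. norm (f x * indicator {l n<..<r n} x) \<le> \<bar>f x\<bar>" for n
        by (auto simp: indicator_def)
      show "(\<lambda>x. f x * indicator {l n<..<r n} x) \<in> borel_measurable unit_meas" for n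
        by (rule borel_measurable_integrable[OF fA]) simp
      show "(\<lambda>x. f x * indicator {a<..<b} x) \<in> borel_measurable unit_meas"
        by (rule borel_measurable_integrable[OF fA]) simp
    qed
    moreover have "(\<lambda>n. \<integral>x. f x * indicator {l n<..<r n} x \<partial>unit_meas) = (\<lambda>n. 0)"
      using interval_integral_zero[OF assms lr] by blast
    ultimately show ?thesis
      using LIMSEQ_unique tendsto_const by metis
  qed
  have box0: "(\<integral>x. f x * indicator {a<..<b} x \<partial>unit_meas) = 0" for a b :: real
  proof (cases "a < b \<and> {a<..<b} \<inter> {0<..<1} \<noteq> {}")
    case False
    then have "f x * indicator {a<..<b} x = 0" if "x \<in> {0<..<1}" for x
      using that by (auto simp: indicator_def)
    then show ?thesis
      by (intro integral_eq_zero_AE AE_I2) simp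
  qed (use open_box in blast)
  \<comment> \<open>The integral over the whole space serves the complement step of the induction
    below.\<close>
  have total: "(\<integral>x. f x \<partial>unit_meas) = 0"
    using box0[of 0 1] by (subst Bochner_Integration.integral_cong[of _ unit_meas _ "\<lambda>x. f x * indicator {0<..<1} x"]) auto
  have borel0: "(\<integral>x. f x * indicator A x \<partial>unit_meas) = 0" if "A \<in> sets borel" for A
  proof -
    \<comment> \<open>Pi-lambda argument: the Borel sets over which \<open>f\<close> integrates to 0
      include the open intervals and are closed under complements and countable disjoint
      unions.\<close>
    have "Int_stable (range (\<lambda>(a, b). {a<..<b::real}))"
      unfolding Int_stable_def by auto
    moreover have "range (\<lambda>(a, b). {a<..<b::real}) \<subseteq> Pow UNIV" by simp
    moreover have "A \<in> sigma_sets UNIV (range (\<lambda>(a, b). {a<..<b::real}))"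
      using that by (simp add: borel_Ioo)
    ultimately show ?thesis
    proof (induction rule: sigma_sets_induct_disjoint)
      case (basic A)
      then show ?case using box0 by auto
    next
      case (compl A)
      have "A \<in> sets borel"
        using compl(1) by (simp add: borel_Ioo)
      then have "(\<integral>x. f x - f x * indicator A x \<partial>unit_meas) = 0"
        using compl(2) total fA f by (subst Bochner_Integration.integral_diff) auto
      moreover have "f x - f x * indicator A x = f x * indicator (UNIV - A) x" for x
        by (auto simp: indicator_def)
      ultimately show ?case by simp
    next
      case (union A)
      have A: "A i \<in> sets borel" for i
        using union(2) by (auto simp: borel_Ioo)
      have "(\<lambda>n. \<integral>x. f x * indicator (\<Union>i<n. A i) x \<partial>unit_meas) \<longlonglongrightarrow>
        (\<integral>x. f x * indicator (\<Union>i. A i) x \<partial>unit_meas)"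
      proof (rule integral_dominated_convergence)
        show "integrable unit_meas (\<lambda>x. \<bar>f x\<bar>)" using f by simp
        show "AE x in unit_meas. (\<lambda>n. f x * indicator (\<Union>i<n. A i) x) \<longlonglongrightarrow> f x * indicator (\<Union>i. A i) x"
          by (intro AE_I2 tendsto_intros LIMSEQ_indicator_UN)
        show "AE x in unit_meas. norm (f x * indicator (\<Union>i<n. A i) x) \<le> \<bar>f x\<bar>" for n
          by (auto simp: indicator_def)
        show "(\<lambda>x. f x * indicator (\<Union>i<n. A i) x) \<in> borel_measurable unit_meas" for n
          by (rule borel_measurable_integrable[OF fA]) (use A in auto)
        show "(\<lambda>x. f x * indicator (\<Union>i. A i) x) \<in> borel_measurable unit_meas"
          by (rule borel_measurable_integrable[OF fA]) (use A in auto)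
      qed
      moreover have "(\<integral>x. f x * indicator (\<Union>i<n. A i) x \<partial>unit_meas) = 0" for n
      proof -
        have "f x * indicator (\<Union>i<n. A i) x = (\<Sum>i<n. f x * indicator (A i) x)" for x
          using union(1) by (subst indicator_UN_disjoint)
            (auto simp: sum_distrib_left disjoint_family_on_def)
        then have "(\<integral>x. f x * indicator (\<Union>i<n. A i) x \<partial>unit_meas) =
            (\<integral>x. (\<Sum>i<n. f x * indicator (A i) x) \<partial>unit_meas)" by (simp only:)
        also have "\<dots> = 0"
          using union(3) by (subst Bochner_Integration.integral_sum) (use fA[OF A] in simp_all)
        finally show ?thesis .
      qed
      ultimately show ?case
        by (simp only: LIMSEQ_const_iff)
    qed auto
  qed
  fix A assume "A \<in> sets unit_meas"
  then have "A \<in> sets lebesgue" and A: "A \<subseteq> {0<..<1}"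
    by (auto simp: sets_restrict_space_iff)
  \<comment> \<open>A Lebesgue set is a Borel set \<open>S\<close> up to a part \<open>N\<close> of
    a null set, so the indicators of \<open>A\<close> and \<open>S\<close> agree almost
    everywhere.\<close>
  then obtain S N N' where S: "S \<in> sets lborel" "N' \<in> null_sets lborel" "N \<subseteq> N'" "A = S \<union> N"
    by (auto elim: sets_completionE)
  have "AE x in unit_meas. x \<notin> N'"
    using AE_completion[OF AE_not_in[OF S(2)]] by (subst AE_restrict_space_iff) auto
  then have "AE x in unit_meas. indicator A x *\<^sub>R f x = f x * indicator S x"
    by eventually_elim (use S in \<open>auto simp: indicator_def\<close>)
  then have "(\<integral>x. indicator A x *\<^sub>R f x \<partial>unit_meas) = (\<integral>x. f x * indicator S x \<partial>unit_meas)"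
    using f S(1) \<open>A \<in> sets unit_meas\<close>
    by (intro integral_cong_AE borel_measurable_scaleR borel_measurable_indicator borel_measurable_times ind) auto
  then show "(LINT x:A|unit_meas. f x) = 0"
    using borel0 S(1) by (simp add: set_lebesgue_integral_def)
qed

section \<open>The du Bois-Reymond lemma and primitives\<close>

text \<open>A bridge from the Bochner integral over \<open>unit_meas\<close> to the gauge integral,
  for which the fundamental theorem of calculus is used; the endpoints carry no mass.\<close>

lemma integral_unit_indicator:
  fixes f :: "real \<Rightarrow> real"
  assumes f: "integrable unit_meas f" and ab: "0 \<le> a" "b \<le> 1"
  shows "(\<integral>x. f x * indicator {a<..<b} x \<partial>unit_meas) = integral {a..b} f"
proof -
  have "(\<integral>x. f x * indicator {a<..<b} x \<partial>unit_meas) =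
      (\<integral>x. (if x \<in> {a<..<b} then f x else 0) \<partial>unit_meas)"
    by (rule Bochner_Integration.integral_cong) auto
  also have "\<dots> = (\<integral>x. f x \<partial>lebesgue_on {a<..<b})"
    using ab by (intro Lebesgue_Measure.integral_restrict) auto
  also have "\<dots> = integral {a<..<b} f"
  proof (rule lebesgue_integral_eq_integral)
    have "integrable lebesgue (\<lambda>x. if x \<in> {0<..<1} then f x else 0)"
      using f by (subst Lebesgue_Measure.integrable_restrict_UNIV) auto
    then have "integrable (lebesgue_on {a<..<b}) (\<lambda>x. if x \<in> {0<..<1} then f x else 0)"
      by (intro integrable_restrict_space[THEN iffD2] integrable_mult_indicator) auto
    then show "integrable (lebesgue_on {a<..<b}) f"
      by (rule Bochner_Integration.integrable_cong[THEN iffD1, rotated 2]) (use ab in auto)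
  qed simp
  finally show ?thesis by (simp add: integral_open_interval_real)
qed

lemma integral_unit:
  fixes f :: "real \<Rightarrow> real"
  assumes "integrable unit_meas f"
  shows "(\<integral>x. f x \<partial>unit_meas) = integral {0..1} f"
  using lebesgue_integral_eq_integral[OF assms] by (simp add: integral_open_interval_real)

lemma integrable_on_Icc:
  fixes f :: "real \<Rightarrow> real"
  assumes "integrable unit_meas f"
  shows "f integrable_on {0..1}"
  using integrable_on_lebesgue_on[OF assms] by (simp add: integrable_on_Icc_iff_Ioo)

lemma FTC_Icc:
  fixes F h :: "real \<Rightarrow> real"
  assumes "a \<le> b" "\<And>x. (F has_real_derivative h x) (at x)"
  shows "integral {a..b} h = F b - F a"
proof (rule integral_unique, rule fundamental_theorem_of_calculus[OF assms(1)])
  fix x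
  show "(F has_vector_derivative h x) (at x within {a..b})"
    using assms(2)[of x] has_field_derivative_at_within
    by (simp add: has_real_derivative_iff_has_vector_derivative[symmetric])
qed

lemma smooth_integrable: "smooth f \<Longrightarrow> integrable unit_meas f"
  by (intro continuous_integrable_unit(1) smooth_continuous_on)

lemma FTC_unit:
  assumes "smooth h" "\<And>x. (F has_real_derivative h x) (at x)"
  shows "(\<integral>x. h x \<partial>unit_meas) = F 1 - F 0"
  using integral_unit[OF smooth_integrable[OF assms(1)]] FTC_Icc[OF _ assms(2), of 0 1] by simp

lemma smooth_antiderivative:
  assumes "smooth h"
  obtains F where "\<And>x. (F has_real_derivative h x) (at x)" "F 0 = 0" "smooth F"
proof -
  \<comment> \<open>Infinite endpoints give a two-sided derivative at every real number, also at 0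
    and 1.\<close>
  have "\<exists>F. \<forall>x::real. -\<infinity> < ereal x \<longrightarrow> ereal x < \<infinity> \<longrightarrow> (F has_vector_derivative h x) (at x)"
    by (rule einterval_antiderivative) (auto intro: DERIV_isCont smooth_derivE(1)[OF assms])
  then obtain F where F: "\<And>x. (F has_real_derivative h x) (at x)"
    by (auto simp: has_real_derivative_iff_has_vector_derivative)
  have F': "((\<lambda>x. F x - F 0) has_real_derivative h x) (at x)" for x
    using DERIV_diff[OF F[of x] DERIV_const[of "F 0"]] by simp
  show ?thesis
    by (rule that[of "\<lambda>x. F x - F 0"]) (use F' smooth_antiderivI[OF F' assms] in auto)
qed

lemma smooth_lincomb:
  assumes "smooth f" "smooth g"
  shows "smooth (\<lambda>x. a * f x + b * g x)"
proof (rule smooth_coinduct[where C = "{\<lambda>x. a * f x + b * g x |f g. smooth f \<and> smooth g}"])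
  fix u assume "u \<in> {\<lambda>x. a * f x + b * g x |f g. smooth f \<and> smooth g}"
  then obtain f g where fg: "smooth f" "smooth g" and u: "u = (\<lambda>x. a * f x + b * g x)" by blast
  show "\<exists>u'\<in>{\<lambda>x. a * f x + b * g x |f g. smooth f \<and> smooth g}. \<forall>x. (u has_real_derivative u' x) (at x)"
    unfolding u using fg
    by (intro bexI[of _ "\<lambda>x. a * deriv f x + b * deriv g x"])
      (auto intro!: derivative_eq_intros smooth_derivE)
qed (use assms in auto)

lemma constant_on_vanishing_derivative:
  fixes F :: "real \<Rightarrow> real"
  assumes "x \<le> y" "\<And>x. (F has_real_derivative h x) (at x)" "\<And>z. x < z \<Longrightarrow> z < y \<Longrightarrow> h z = 0"
  shows "F x = F y"
proof (cases "x < y")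
  case True
  obtain z where "x < z" "z < y" "F y - F x = (y - x) * h z"
    using MVT2[OF True, of F h] assms(2) by blast
  then show ?thesis using assms(3) by simp
qed (use assms in simp)

text \<open>Justifies dividing by the mass of a fixed bump in the du Bois-Reymond lemma. An
  antiderivative is nondecreasing and increases strictly from \<open>a\<close> to
  \<open>b\<close>.\<close>

lemma bump_integral_pos:
  assumes "0 < a" "a < b" "b < 1"
  shows "(\<integral>x. bump a b n x \<partial>unit_meas) > 0"
proof -
  obtain F where F: "\<And>x. (F has_real_derivative bump a b n x) (at x)"
    using smooth_antiderivative[OF smooth_bump] by metis
  have mono: "F x \<le> F y" if "x \<le> y" for x y
    by (rule DERIV_nonneg_imp_nondecreasing[OF that]) (use F bump_bounds(1) in blast)
  have "F 0 \<le> F a" "F b \<le> F 1"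
    using assms by (auto intro: mono)
  moreover have "F a < F b"
  proof (rule DERIV_pos_imp_increasing_open[OF assms(2)])
    fix x assume "a < x" "x < b"
    then have "0 < bump a b n x" by (simp add: bump_eq)
    then show "\<exists>y. (F has_real_derivative y) (at x) \<and> 0 < y" using F by blast
  next
    show "continuous_on {a..b} F"
      using F DERIV_isCont continuous_at_imp_continuous_on by blast
  qed
  ultimately show ?thesis
    using FTC_unit[OF smooth_bump F] by simp
qed

lemma test_fun_boundary:
  assumes "test_fun \<phi>"
  shows "\<phi> 0 = 0" "\<phi> 1 = 0"
proof -
  have "{x. \<phi> x \<noteq> 0} \<subseteq> {0<..<1}"
    by (rule order_trans[OF closure_subset]) (use assms in \<open>simp add: test_fun_iff\<close>)
  then show "\<phi> 0 = 0" "\<phi> 1 = 0" by auto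
qed

text \<open>Derivatives of test functions have mean zero, so the hypothesis sees \<open>f\<close>
  only up to a constant. That constant has to be the mean of \<open>f\<close> weighted by a fixed
  bump \<open>\<eta>\<close>; the fundamental lemma is applied to \<open>f - c\<close>.\<close>

lemma du_Bois_Reymond:
  fixes f :: "real \<Rightarrow> real"
  assumes f: "integrable unit_meas f"
    and test: "\<And>\<phi>. test_fun \<phi> \<Longrightarrow> (\<integral>x. f x * deriv \<phi> x \<partial>unit_meas) = 0"
  shows "\<exists>c. AE x in unit_meas. f x = c"
proof -
  define \<eta> where "\<eta> = bump (1/4) (3/4) 0"
  define I where "I = (\<integral>x. \<eta> x \<partial>unit_meas)"
  have I: "I > 0" unfolding I_def \<eta>_def by (rule bump_integral_pos) auto
  define c where "c = (\<integral>x. f x * \<eta> x \<partial>unit_meas) / I"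
  have smooth_\<eta>: "smooth \<eta>" unfolding \<eta>_def by (rule smooth_bump)
  have int: "integrable unit_meas (\<lambda>x. f x * h x)" if "smooth h" for h
    by (rule integrable_mult_continuous[OF f smooth_continuous_on[OF that]])
  have "AE x in unit_meas. f x - c = 0"
  proof (rule fundamental_lemma)
    show "integrable unit_meas (\<lambda>x. f x - c)" using f by simp
    fix a b :: real and n assume ab: "0 < a" "a < b" "b < 1"
    define \<psi> where "\<psi> = bump a b n"
    have smooth_\<psi>: "smooth \<psi>" unfolding \<psi>_def by (rule smooth_bump)
    txt \<open>Subtracting a multiple of \<open>\<eta>\<close> makes the mean zero, so that the primitive is a test
      function.\<close>
    define k where "k = (\<integral>x. \<psi> x \<partial>unit_meas) / I"
    define h where "h x = 1 * \<psi> x + (- k) * \<eta> x" for x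
    have smooth_h: "smooth h"
      unfolding h_def by (rule smooth_lincomb[OF smooth_\<psi> smooth_\<eta>])
    obtain F where F: "\<And>x. (F has_real_derivative h x) (at x)" "F 0 = 0" "smooth F"
      using smooth_antiderivative[OF smooth_h] by metis
    have "(\<integral>x. h x \<partial>unit_meas) = (\<integral>x. \<psi> x \<partial>unit_meas) - k * I"
      unfolding h_def I_def using smooth_integrable[OF smooth_\<psi>] smooth_integrable[OF smooth_\<eta>]
      by simp
    then have "F 1 = 0" using FTC_unit[OF smooth_h F(1)] F(2) I by (simp add: k_def)
    \<comment> \<open>The interval from \<open>l\<close> to \<open>r\<close> contains the supports
      of both bumps. Outside it \<open>F\<close> is constant on each side, with value
      \<open>F 0 = 0\<close> on the left and \<open>F 1 = 0\<close> on the right.\<close>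
    define l r where "l = min a (1/4)" and "r = max b (3/4)"
    have h0: "h x = 0" if "x \<le> l \<or> r \<le> x" for x
      using that by (auto simp: h_def \<psi>_def \<eta>_def bump_eq l_def r_def)
    have lr: "0 < l" "r < 1" using ab by (auto simp: l_def r_def)
    have "F x = 0" if "x \<le> l" for x
      using constant_on_vanishing_derivative[of x l F h, OF that F(1)]
        constant_on_vanishing_derivative[of 0 l F h, OF _ F(1)] lr h0 F(2) by auto
    moreover have "F x = 0" if "r \<le> x" for x
      using constant_on_vanishing_derivative[of r x F h, OF that F(1)]
        constant_on_vanishing_derivative[of r 1 F h, OF _ F(1)] lr h0 \<open>F 1 = 0\<close> by auto
    ultimately have "test_fun F"
      using lr by (intro test_funI[OF F(3), of l r]) auto
    moreover have "deriv F = h"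
      using F(1) DERIV_imp_deriv by blast
    ultimately have "0 = (\<integral>x. f x * h x \<partial>unit_meas)" using test by metis
    also have "\<dots> = (\<integral>x. f x * \<psi> x - k * (f x * \<eta> x) \<partial>unit_meas)"
      by (simp add: h_def algebra_simps)
    also have "\<dots> = (\<integral>x. f x * \<psi> x \<partial>unit_meas) - k * (\<integral>x. f x * \<eta> x \<partial>unit_meas)"
      using int[OF smooth_\<psi>] int[OF smooth_\<eta>] by simp
    \<comment> \<open>Both sides are the product of the two integrals divided by \<open>I\<close>;
      this is where the choice of \<open>c\<close> enters.\<close>
    also have "k * (\<integral>x. f x * \<eta> x \<partial>unit_meas) = c * (\<integral>x. \<psi> x \<partial>unit_meas)"
      by (simp add: k_def c_def)
    finally have "(\<integral>x. f x * \<psi> x \<partial>unit_meas) - c * (\<integral>x. \<psi> x \<partial>unit_meas) = 0" by simp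
    moreover have "(\<integral>x. (f x - c) * \<psi> x \<partial>unit_meas) =
        (\<integral>x. f x * \<psi> x \<partial>unit_meas) - c * (\<integral>x. \<psi> x \<partial>unit_meas)"
      using int[OF smooth_\<psi>] smooth_integrable[OF smooth_\<psi>] by (simp add: left_diff_distrib)
    ultimately show "(\<integral>x. (f x - c) * bump a b n x \<partial>unit_meas) = 0"
      unfolding \<psi>_def by simp
  qed
  then show ?thesis by auto
qed

text \<open>Integration by parts for a merely integrable \<open>g\<close>, by Fubini on the triangle
  t < x: integrating in t first gives the primitive, integrating in x first gives
  \<open>\<phi> 1 - \<phi> t\<close>, which is \<open>- \<phi> t\<close>.\<close>

lemma primitive_weak_deriv:
  fixes g :: "real \<Rightarrow> real"
  assumes g: "integrable unit_meas g" and \<phi>: "test_fun \<phi>"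
  shows "(\<integral>x. integral {0..x} g * deriv \<phi> x \<partial>unit_meas) = - (\<integral>x. g x * \<phi> x \<partial>unit_meas)"
proof -
  interpret P: pair_sigma_finite unit_meas unit_meas ..
  have smooth: "smooth \<phi>" "smooth (deriv \<phi>)"
    using \<phi> smooth_derivE(2) by (auto simp: test_fun_iff)
  obtain B where B: "\<And>x. x \<in> {0<..<1} \<Longrightarrow> \<bar>deriv \<phi> x\<bar> \<le> B"
    using continuous_bounded_unit[OF smooth_continuous_on[OF smooth(2)]] by blast
  have id_meas: "(\<lambda>x. x) \<in> borel_measurable unit_meas"
    by (rule continuous_measurable_unit) simp
  have g_meas [measurable]: "g \<in> borel_measurable unit_meas" using g by simp
  have d_meas [measurable]: "deriv \<phi> \<in> borel_measurable unit_meas"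
    by (rule borel_measurable_integrable[OF smooth_integrable[OF smooth(2)]])
  define K where "K t x = g t * deriv \<phi> x * (if t < x then 1 else 0)" for t x
  have [measurable]: "fst \<in> borel_measurable (unit_meas \<Otimes>\<^sub>M unit_meas)"
    "snd \<in> borel_measurable (unit_meas \<Otimes>\<^sub>M unit_meas)"
    using measurable_compose[OF measurable_fst id_meas] measurable_compose[OF measurable_snd id_meas] by auto
  have K_meas: "case_prod K \<in> borel_measurable (unit_meas \<Otimes>\<^sub>M unit_meas)"
    unfolding K_def case_prod_beta by measurable
  have K_int: "integrable (unit_meas \<Otimes>\<^sub>M unit_meas) (case_prod K)"
  proof (rule P.Fubini_integrable[OF K_meas])
    \<comment> \<open>A bound depending on \<open>t\<close> alone suffices for joint integrability,
      since the measure in \<open>x\<close> is finite.\<close>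
    have bd: "\<bar>K t x\<bar> \<le> \<bar>g t\<bar> * B" if "x \<in> {0<..<1}" for t x
      using B[OF that] mult_left_mono[OF B[OF that] abs_ge_zero[of "g t"]]
        mult_nonneg_nonneg[of "\<bar>g t\<bar>" B]
      by (auto simp: K_def abs_mult)
    have sec: "integrable unit_meas (K t)" if "t \<in> space unit_meas" for t
    proof (rule bounded_integrable_unit[OF _ bd])
      show "K t \<in> borel_measurable unit_meas"
        using measurable_Pair2[OF K_meas that] by simp
    qed
    then show "AE t in unit_meas. integrable unit_meas (\<lambda>x. case_prod K (t, x))"
      by (intro AE_I2) simp
    show "integrable unit_meas (\<lambda>t. \<integral>x. norm (case_prod K (t, x)) \<partial>unit_meas)"
    proof (rule Bochner_Integration.integrable_bound)
      show "integrable unit_meas (\<lambda>t. \<bar>g t\<bar> * B)" using g by simp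
      show "(\<lambda>t. \<integral>x. norm (case_prod K (t, x)) \<partial>unit_meas) \<in> borel_measurable unit_meas"
        using K_meas by (intro unit.borel_measurable_lebesgue_integral) (auto simp: case_prod_beta')
      show "AE t in unit_meas. norm (\<integral>x. norm (case_prod K (t, x)) \<partial>unit_meas) \<le> norm (\<bar>g t\<bar> * B)"
      proof (rule AE_I2)
        fix t assume t: "t \<in> space unit_meas"
        have "0 \<le> (\<integral>x. norm (K t x) \<partial>unit_meas)" by simp
        moreover have "(\<integral>x. norm (K t x) \<partial>unit_meas) \<le> (\<integral>x. \<bar>g t\<bar> * B \<partial>unit_meas)"
          using sec[OF t] bd by (intro integral_mono) auto
        ultimately show "norm (\<integral>x. norm (case_prod K (t, x)) \<partial>unit_meas) \<le> norm (\<bar>g t\<bar> * B)" by simp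
      qed
    qed
  qed
  have inner_t: "(\<integral>t. K t x \<partial>unit_meas) = integral {0..x} g * deriv \<phi> x" if "x \<in> space unit_meas" for x
  proof -
    have "(\<integral>t. K t x \<partial>unit_meas) = (\<integral>t. deriv \<phi> x * (g t * indicator {0<..<x} t) \<partial>unit_meas)"
      by (rule Bochner_Integration.integral_cong) (auto simp: K_def)
    then show ?thesis
      using integral_unit_indicator[OF g, of 0 x] that by simp
  qed
  have inner_x: "(\<integral>x. K t x \<partial>unit_meas) = - (g t * \<phi> t)" if "t \<in> space unit_meas" for t
  proof -
    have "(\<integral>x. K t x \<partial>unit_meas) = (\<integral>x. g t * (deriv \<phi> x * indicator {t<..<1} x) \<partial>unit_meas)"
      by (rule Bochner_Integration.integral_cong) (auto simp: K_def)
    also have "\<dots> = g t * (\<phi> 1 - \<phi> t)"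
      using integral_unit_indicator[OF smooth_integrable[OF smooth(2)], of t 1] that
        FTC_Icc[OF _ smooth_derivE(1)[OF smooth(1)], of t 1] by simp
    finally show ?thesis using test_fun_boundary(2)[OF \<phi>] by simp
  qed
  have "(\<integral>x. integral {0..x} g * deriv \<phi> x \<partial>unit_meas) = (\<integral>x. (\<integral>t. K t x \<partial>unit_meas) \<partial>unit_meas)"
    by (rule Bochner_Integration.integral_cong) (auto simp: inner_t)
  also have "\<dots> = (\<integral>t. (\<integral>x. K t x \<partial>unit_meas) \<partial>unit_meas)"
    by (rule P.Fubini_integral[OF K_int])
  also have "\<dots> = (\<integral>t. - (g t * \<phi> t) \<partial>unit_meas)"
    by (rule Bochner_Integration.integral_cong) (auto simp: inner_x)
  finally show ?thesis by simp
qed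

section \<open>Functions of class H1 and weak solutions\<close>

lemma L2_integrable:
  assumes "u \<in> L2"
  shows "integrable unit_meas u" "integrable unit_meas (\<lambda>x. (u x)\<^sup>2)"
proof -
  show sq: "integrable unit_meas (\<lambda>x. (u x)\<^sup>2)" using assms by (simp add: L2_def)
  show "integrable unit_meas u"
  proof (rule Bochner_Integration.integrable_bound)
    show "integrable unit_meas (\<lambda>x. 1 + (u x)\<^sup>2)" using sq by simp
    show "u \<in> borel_measurable unit_meas" using assms by (simp add: L2_def)
    have "\<bar>y\<bar> \<le> \<bar>1 + y\<^sup>2\<bar>" for y :: real
    proof -
      have "0 \<le> (\<bar>y\<bar> - 1)\<^sup>2 + y\<^sup>2" by simp
      then have "\<bar>y\<bar> \<le> 1 + y\<^sup>2" by (simp add: power2_diff)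
      then show ?thesis by simp
    qed
    then show "AE x in unit_meas. norm (u x) \<le> norm (1 + (u x)\<^sup>2)" by simp
  qed
qed

lemma continuous_L2:
  assumes "continuous_on {0..1} u"
  shows "u \<in> L2"
  unfolding L2_def using continuous_integrable_unit[OF assms]
    continuous_integrable_unit(1)[OF continuous_on_power[OF assms, of 2]] by simp

lemma weak_deriv_props:
  assumes "u \<in> H1"
  shows "weak_deriv u \<in> L2" "is_weak_deriv u (weak_deriv u)"
proof -
  have "\<exists>g. g \<in> L2 \<and> is_weak_deriv u g" using assms by (auto simp: H1_def)
  then have "weak_deriv u \<in> L2 \<and> is_weak_deriv u (weak_deriv u)"
    unfolding weak_deriv_def by (rule someI_ex)
  then show "weak_deriv u \<in> L2" "is_weak_deriv u (weak_deriv u)" by blast+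
qed

lemma integrable_test: "integrable unit_meas g \<Longrightarrow> smooth \<phi> \<Longrightarrow> integrable unit_meas (\<lambda>x. g x * \<phi> x)"
  by (rule integrable_mult_continuous[OF _ smooth_continuous_on])

text \<open>Shows that the choice in \<open>weak_deriv\<close> matters only on a null set.\<close>

lemma is_weak_deriv_unique:
  assumes "is_weak_deriv u g" "is_weak_deriv u h"
    and g: "integrable unit_meas g" and h: "integrable unit_meas h"
  shows "AE x in unit_meas. g x = h x"
proof -
  have "AE x in unit_meas. g x - h x = 0"
  proof (rule fundamental_lemma)
    fix a b :: real and n assume "0 < a" "a < b" "b < 1"
    then have "test_fun (bump a b n)" by (intro test_fun_bump)
    from assms(1,2)[unfolded is_weak_deriv_def, rule_format, OF this]
    have "(\<integral>x. g x * bump a b n x \<partial>unit_meas) = (\<integral>x. h x * bump a b n x \<partial>unit_meas)"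
      by linarith
    then show "(\<integral>x. (g x - h x) * bump a b n x \<partial>unit_meas) = 0"
      using integrable_test[OF g smooth_bump] integrable_test[OF h smooth_bump]
      by (simp add: left_diff_distrib)
  qed (use g h in simp)
  then show ?thesis by simp
qed

lemma smooth_is_weak_deriv:
  assumes "smooth f"
  shows "is_weak_deriv f (deriv f)"
  unfolding is_weak_deriv_def
proof (intro allI impI)
  fix \<phi> assume \<phi>: "test_fun \<phi>"
  then have s: "smooth \<phi>" by (simp add: test_fun_iff)
  note i1 = integrable_test[OF smooth_integrable[OF assms] smooth_derivE(2)[OF s]]
  note i2 = integrable_test[OF smooth_integrable[OF smooth_derivE(2)[OF assms]] s]
  have "((\<lambda>x. f x * \<phi> x) has_real_derivative (f x * deriv \<phi> x + deriv f x * \<phi> x)) (at x)" for x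
    using DERIV_mult[OF smooth_derivE(1)[OF assms] smooth_derivE(1)[OF s]]
    by (simp add: algebra_simps)
  from FTC_Icc[OF _ this, of 0 1]
  have "integral {0..1} (\<lambda>x. f x * deriv \<phi> x + deriv f x * \<phi> x) = 0"
    using test_fun_boundary[OF \<phi>] by simp
  then have "(\<integral>x. f x * deriv \<phi> x + deriv f x * \<phi> x \<partial>unit_meas) = 0"
    using i1 i2 by (subst integral_unit) auto
  then show "(\<integral>x. f x * deriv \<phi> x \<partial>unit_meas) = - (\<integral>x. deriv f x * \<phi> x \<partial>unit_meas)"
    using i1 i2 by simp
qed

text \<open>Admits smooth functions, including those that do not vanish at the endpoints, to the
  weak formulation, with the classical derivative in place of the chosen one.\<close>

lemma smooth_H1:
  assumes "smooth f"
  shows "f \<in> H1" "AE x in unit_meas. weak_deriv f x = deriv f x"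
proof -
  have L2: "h \<in> L2" if "smooth h" for h
    by (rule continuous_L2[OF smooth_continuous_on[OF that]])
  note d = smooth_derivE(2)[OF assms]
  show H1: "f \<in> H1"
    using L2[OF assms] L2[OF d] smooth_is_weak_deriv[OF assms] by (auto simp: H1_def)
  show "AE x in unit_meas. weak_deriv f x = deriv f x"
    by (rule is_weak_deriv_unique[OF weak_deriv_props(2)[OF H1] smooth_is_weak_deriv[OF assms]
          L2_integrable(1)[OF weak_deriv_props(1)[OF H1]] L2_integrable(1)[OF L2[OF d]]])
qed

section \<open>Continuous representatives and primitives\<close>

text \<open>The points of (0,1) where the functions differ form an open negligible set, which must
  be empty; continuity then covers the endpoints.\<close>

lemma continuous_AE_eq:
  fixes v w :: "real \<Rightarrow> real"
  assumes cont: "continuous_on {0..1} v" "continuous_on {0..1} w"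
    and ae: "AE x in unit_meas. v x = w x" and x: "x \<in> {0..1}"
  shows "v x = w x"
proof -
  define h where "h x = v x - w x" for x
  have ch: "continuous_on {0..1} h" unfolding h_def by (intro continuous_intros cont)
  have "AE x in unit_meas. h x = 0" using ae by eventually_elim (simp add: h_def)
  then have "AE x in lebesgue. x \<in> {0<..<1} \<longrightarrow> h x = 0"
    by (subst (asm) AE_restrict_space_iff) auto
  then have "negligible {x. \<not> (x \<in> {0<..<1} \<longrightarrow> h x = 0)}"
    using AE_iff_null_sets[of "{x. \<not> (x \<in> {0<..<1} \<longrightarrow> h x = 0)}" lebesgue]
    by (auto simp: negligible_iff_null_sets eventually_ae_filter elim: completion.complete2)
  then have neg: "negligible {x \<in> {0<..<1}. h x \<noteq> 0}"
    by (rule negligible_subset) auto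
  have "open ({0<..<1} \<inter> h -` (- {0}))"
    by (rule continuous_open_preimage) (auto intro: continuous_on_subset[OF ch])
  moreover have "{0<..<1} \<inter> h -` (- {0}) = {x \<in> {0<..<1}. h x \<noteq> 0}" by auto
  ultimately have "{x \<in> {0<..<1}. h x \<noteq> 0} = {}"
    using neg open_not_negligible by metis
  then have "h y = 0" if "y \<in> {0<..<1}" for y using that by blast
  then have "h x = 0"
    using x ch by (intro continuous_constant_on_closure[of "{0<..<1}" h 0 x]) auto
  then show ?thesis by (simp add: h_def)
qed

text \<open>The primitive of \<open>weak_deriv u\<close> has the same weak derivative as
  \<open>u\<close>, so the du Bois-Reymond lemma applies to the difference.\<close>

lemma H1_primitive:
  assumes "u \<in> H1"
  shows "\<exists>c. AE x in unit_meas. u x = c + integral {0..x} (weak_deriv u)"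
proof -
  define g where "g = weak_deriv u"
  define G where "G x = integral {0..x} g" for x
  have g: "integrable unit_meas g"
    unfolding g_def by (rule L2_integrable(1)[OF weak_deriv_props(1)[OF assms]])
  have u: "integrable unit_meas u"
    using assms L2_integrable(1) by (auto simp: H1_def)
  have G: "integrable unit_meas G"
    unfolding G_def
    by (rule continuous_integrable_unit(1)[OF indefinite_integral_continuous_1[OF integrable_on_Icc[OF g]]])
  have "\<exists>c. AE x in unit_meas. u x - G x = c"
  proof (rule du_Bois_Reymond)
    fix \<phi> assume \<phi>: "test_fun \<phi>"
    then have s: "smooth (deriv \<phi>)" using smooth_derivE(2) by (simp add: test_fun_iff)
    have "(\<integral>x. u x * deriv \<phi> x \<partial>unit_meas) = (\<integral>x. G x * deriv \<phi> x \<partial>unit_meas)"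
      using weak_deriv_props(2)[OF assms] primitive_weak_deriv[OF g \<phi>] \<phi>
      by (simp add: is_weak_deriv_def g_def G_def)
    then show "(\<integral>x. (u x - G x) * deriv \<phi> x \<partial>unit_meas) = 0"
      using integrable_test[OF u s] integrable_test[OF G s] by (simp add: left_diff_distrib)
  qed (use u G in simp)
  then obtain c where "AE x in unit_meas. u x - G x = c" by blast
  then have "AE x in unit_meas. u x = c + integral {0..x} (weak_deriv u)"
    by eventually_elim (simp add: G_def g_def algebra_simps)
  then show ?thesis by blast
qed

lemma primitive_continuous:
  assumes "u \<in> H1"
  shows "continuous_on {0..1} (\<lambda>x. c + integral {0..x} (weak_deriv u))"
  by (rule continuous_on_add[OF continuous_on_const indefinite_integral_continuous_1[OF
      integrable_on_Icc[OF L2_integrable(1)[OF weak_deriv_props(1)[OF assms]]]]])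

text \<open>The primitive just found is a witness for the choice in \<open>cont_rep\<close>.\<close>

lemma cont_rep_props:
  assumes "u \<in> H1"
  shows "continuous_on {0..1} (cont_rep u)" "AE x in unit_meas. u x = cont_rep u x"
proof -
  have "\<exists>v. continuous_on {0..1} v \<and> (AE x in unit_meas. u x = v x)"
    using H1_primitive[OF assms] primitive_continuous[OF assms] by metis
  then have "continuous_on {0..1} (cont_rep u) \<and> (AE x in unit_meas. u x = cont_rep u x)"
    unfolding cont_rep_def by (rule someI_ex)
  then show "continuous_on {0..1} (cont_rep u)" "AE x in unit_meas. u x = cont_rep u x" by blast+
qed

lemma cont_rep_smooth:
  assumes "smooth f" "x \<in> {0..1}"
  shows "cont_rep f x = f x"
proof (rule continuous_AE_eq[OF _ smooth_continuous_on[OF assms(1)] _ assms(2)])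
  show "continuous_on {0..1} (cont_rep f)" by (rule cont_rep_props(1)[OF smooth_H1(1)[OF assms(1)]])
  show "AE x in unit_meas. cont_rep f x = f x"
    using cont_rep_props(2)[OF smooth_H1(1)[OF assms(1)]] by eventually_elim simp
qed

text \<open>Upgrades the almost everywhere identity by continuity to all of [0,1], so that it
  includes the boundary values.\<close>

lemma cont_rep_primitive:
  assumes "u \<in> H1"
  shows "\<exists>c. \<forall>x\<in>{0..1}. cont_rep u x = c + integral {0..x} (weak_deriv u)"
proof -
  obtain c where "AE x in unit_meas. u x = c + integral {0..x} (weak_deriv u)"
    using H1_primitive[OF assms] by blast
  with cont_rep_props(2)[OF assms]
  have "AE x in unit_meas. cont_rep u x = c + integral {0..x} (weak_deriv u)"
    by eventually_elim simp
  then show ?thesis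
    using continuous_AE_eq[OF cont_rep_props(1)[OF assms] primitive_continuous[OF assms]] by blast
qed

section \<open>From the weak formulation to the differential equation\<close>

text \<open>The test function 1 balances the boundary fluxes. An antiderivative of a bump that
  vanishes at 0 keeps only the boundary term at 1, where its value is the mass of the bump; hence
  the flux plus \<open>\<beta> * cont_rep \<rho> 1\<close> is orthogonal to all bumps.\<close>

lemma weak_solution_flux:
  assumes sol: "weak_solution \<epsilon> \<alpha> \<beta> \<rho>"
  shows "\<alpha> * (1 - cont_rep \<rho> 0) = \<beta> * cont_rep \<rho> 1"
    and "AE x in unit_meas. \<epsilon> * weak_deriv \<rho> x - \<rho> x * (1 - \<rho> x) = - (\<beta> * cont_rep \<rho> 1)"
proof -
  define F where "F x = \<epsilon> * weak_deriv \<rho> x - \<rho> x * (1 - \<rho> x)" for x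
  have H1: "\<rho> \<in> H1" using sol by (simp add: weak_solution_def)
  then have L2: "\<rho> \<in> L2" by (simp add: H1_def)
  have "integrable unit_meas (\<lambda>x. \<epsilon> * weak_deriv \<rho> x - (\<rho> x - (\<rho> x)\<^sup>2))"
    using L2_integrable[OF L2] L2_integrable(1)[OF weak_deriv_props(1)[OF H1]] by simp
  also have "(\<lambda>x. \<epsilon> * weak_deriv \<rho> x - (\<rho> x - (\<rho> x)\<^sup>2)) = F"
    by (simp add: fun_eq_iff F_def power2_eq_square algebra_simps)
  finally have F: "integrable unit_meas F" .
  have test: "(\<integral>x. F x * deriv \<phi> x \<partial>unit_meas) - \<alpha> * (1 - cont_rep \<rho> 0) * \<phi> 0
      + \<beta> * cont_rep \<rho> 1 * \<phi> 1 = 0" if \<phi>: "smooth \<phi>" for \<phi>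
  proof -
    have "(\<integral>x. F x * weak_deriv \<phi> x \<partial>unit_meas) = (\<integral>x. F x * deriv \<phi> x \<partial>unit_meas)"
    proof (rule integral_cong_AE)
      show "AE x in unit_meas. F x * weak_deriv \<phi> x = F x * deriv \<phi> x"
        using smooth_H1(2)[OF \<phi>] by eventually_elim simp
      show "(\<lambda>x. F x * weak_deriv \<phi> x) \<in> borel_measurable unit_meas"
        using F L2_integrable(1)[OF weak_deriv_props(1)[OF smooth_H1(1)[OF \<phi>]]]
        by (intro borel_measurable_times) auto
      show "(\<lambda>x. F x * deriv \<phi> x) \<in> borel_measurable unit_meas"
        using integrable_test[OF F smooth_derivE(2)[OF \<phi>]] by simp
    qed
    moreover have "(\<integral>x. F x * weak_deriv \<phi> x \<partial>unit_meas) - \<alpha> * (1 - cont_rep \<rho> 0) * cont_rep \<phi> 0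
      + \<beta> * cont_rep \<rho> 1 * cont_rep \<phi> 1 = 0"
      using sol smooth_H1(1)[OF \<phi>] unfolding weak_solution_def F_def by blast
    ultimately show ?thesis using cont_rep_smooth[OF \<phi>] by simp
  qed
  show "\<alpha> * (1 - cont_rep \<rho> 0) = \<beta> * cont_rep \<rho> 1"
    using test[OF smooth_const[of 1]] by simp
  have "AE x in unit_meas. F x + \<beta> * cont_rep \<rho> 1 = 0"
  proof (rule fundamental_lemma)
    fix a b :: real and n assume "0 < a" "a < b" "b < 1"
    obtain \<phi> where \<phi>: "\<And>x. (\<phi> has_real_derivative bump a b n x) (at x)" "\<phi> 0 = 0" "smooth \<phi>"
      using smooth_antiderivative[OF smooth_bump] by metis
    have "deriv \<phi> = bump a b n" using \<phi>(1) DERIV_imp_deriv by blast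
    then have "(\<integral>x. F x * bump a b n x \<partial>unit_meas)
        + \<beta> * cont_rep \<rho> 1 * (\<integral>x. bump a b n x \<partial>unit_meas) = 0"
      using test[OF \<phi>(3)] FTC_unit[OF smooth_bump \<phi>(1)] \<phi>(2) by simp
    then show "(\<integral>x. (F x + \<beta> * cont_rep \<rho> 1) * bump a b n x \<partial>unit_meas) = 0"
      using integrable_test[OF F smooth_bump] smooth_integrable[OF smooth_bump]
      by (simp add: distrib_right)
  qed (use F in simp)
  then show "AE x in unit_meas. \<epsilon> * weak_deriv \<rho> x - \<rho> x * (1 - \<rho> x) = - (\<beta> * cont_rep \<rho> 1)"
    by eventually_elim (simp add: F_def)
qed

text \<open>By the flux identity the weak derivative equals a continuous expression in
  \<open>v\<close> almost everywhere. So \<open>v\<close> is a primitive of a continuous function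
  and is differentiable on all of [0,1], one-sidedly at the ends.\<close>

lemma weak_solution_ode:
  assumes sol: "weak_solution \<epsilon> \<alpha> \<beta> \<rho>" and \<epsilon>: "\<epsilon> > 0" and x: "x \<in> {0..1}"
  defines "v \<equiv> cont_rep \<rho>"
  shows "(v has_real_derivative (v x * (1 - v x) - \<beta> * v 1) / \<epsilon>) (at x within {0..1})"
proof -
  define g where "g = weak_deriv \<rho>"
  define h where "h x = (v x * (1 - v x) - \<beta> * v 1) / \<epsilon>" for x
  have H1: "\<rho> \<in> H1" using sol by (simp add: weak_solution_def)
  have cv: "continuous_on {0..1} v" unfolding v_def by (rule cont_rep_props(1)[OF H1])
  have ch: "continuous_on {0..1} h" unfolding h_def using \<epsilon> by (intro continuous_intros cv) auto
  have g: "integrable unit_meas g"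
    unfolding g_def by (rule L2_integrable(1)[OF weak_deriv_props(1)[OF H1]])
  have h: "integrable unit_meas h" by (rule continuous_integrable_unit(1)[OF ch])
  have ind: "indicator {0<..<y} \<in> borel_measurable unit_meas" for y :: real
    by (intro measurable_restrict_space1 measurable_completion) simp
  have gh: "AE x in unit_meas. g x = h x"
    using weak_solution_flux(2)[OF sol] cont_rep_props(2)[OF H1]
  proof eventually_elim
    case (elim x)
    then have "\<epsilon> * g x = v x * (1 - v x) - \<beta> * v 1"
      by (simp add: v_def g_def)
    then show ?case using \<epsilon> by (simp add: h_def field_simps)
  qed
  \<comment> \<open>The detour through the Bochner integral lets the almost everywhere equality of
    the integrands be used.\<close>
  have int_eq: "integral {0..y} g = integral {0..y} h" if "y \<in> {0..1}" for y
  proof -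
    have "(\<integral>x. g x * indicator {0<..<y} x \<partial>unit_meas) = (\<integral>x. h x * indicator {0<..<y} x \<partial>unit_meas)"
    proof (rule integral_cong_AE)
      show "AE x in unit_meas. g x * indicator {0<..<y} x = h x * indicator {0<..<y} x"
        using gh by eventually_elim simp
    qed (use g h ind in \<open>auto intro!: borel_measurable_times\<close>)
    then show ?thesis
      using integral_unit_indicator[OF g, of 0 y] integral_unit_indicator[OF h, of 0 y] that by simp
  qed
  obtain c where "\<forall>x\<in>{0..1}. v x = c + integral {0..x} g"
    using cont_rep_primitive[OF H1] unfolding v_def g_def by blast
  then have v_eq: "v y = c + integral {0..y} h" if "y \<in> {0..1}" for y
    using that int_eq by simp
  have "((\<lambda>y. c + integral {0..y} h) has_real_derivative h x) (at x within {0..1})"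
    using DERIV_add[OF DERIV_const[of c] integral_has_real_derivative[OF ch x]] by simp
  then have "(v has_real_derivative h x) (at x within {0..1})"
    by (rule has_field_derivative_transform_within[OF _ zero_less_one x]) (use v_eq in auto)
  then show ?thesis by (simp add: h_def)
qed

section \<open>The stationary equation as an ordinary differential equation\<close>

text \<open>Stated for any solution \<open>v\<close> of the boundary value problem, so that it
  serves the continuous representative as well as its reflection.\<close>

lemma ode_bound:
  fixes v :: "real \<Rightarrow> real"
  assumes \<epsilon>: "\<epsilon> > 0" and \<alpha>: "0 \<le> \<alpha>" "\<alpha> < \<beta>" "\<beta> < 1 / 2"
    and bc: "\<alpha> * (1 - v 0) = \<beta> * v 1"
    and ode: "\<And>x. x \<in> {0..1} \<Longrightarrow>
      (v has_real_derivative (v x * (1 - v x) - \<beta> * v 1) / \<epsilon>) (at x within {0..1})"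
  shows "integral {0..1} (\<lambda>x. \<bar>v x - \<alpha>\<bar>) \<le> \<epsilon> * ((1 - \<alpha> - \<beta>) / (\<beta> - \<alpha>))"
proof -
  define w where "w x = v x * (1 - v x) - \<beta> * v 1" for x
  have cv: "continuous_on {0..1} v"
    using ode by (meson DERIV_continuous continuous_on_eq_continuous_within)
  have v_interior: "(v has_real_derivative w x / \<epsilon>) (at x)" if "0 < x" "x < 1" for x
    using ode[of x] that by (simp add: w_def at_within_Icc_at)
  \<comment> \<open>Differentiating \<open>w\<close> gives (1 - 2 v) v', and v' is
    \<open>w x / \<epsilon>\<close>; so \<open>a\<close> is the coefficient of the linear equation
    w' = a w.\<close>
  define a where "a x = (1 - 2 * v x) / \<epsilon>" for x
  define A where "A x = integral {0..x} a" for x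
  have "continuous_on {0..1} a" unfolding a_def using \<epsilon> by (intro continuous_intros cv) auto
  then have A: "(A has_real_derivative a x) (at x within {0..1})" if "x \<in> {0..1}" for x
    unfolding A_def using that by (intro integral_has_real_derivative)
  have w': "(w has_real_derivative a x * w x) (at x within {0..1})" if "x \<in> {0..1}" for x
    unfolding w_def a_def
    by (rule derivative_eq_intros ode[OF that] refl)+ (use \<epsilon> in \<open>simp add: field_simps\<close>)
  \<comment> \<open>The integrating factor turns the linear equation into constancy, so
    \<open>w\<close> keeps the sign of \<open>w 0\<close>.\<close>
  have "((\<lambda>x. w x * exp (- A x)) has_real_derivative 0) (at x within {0..1})" if "x \<in> {0..1}" for x
    by (rule derivative_eq_intros w'[OF that] A[OF that] refl)+ (simp add: algebra_simps)
  then have "\<exists>c. \<forall>x\<in>{0..1}. w x * exp (- A x) = c"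
    by (intro has_field_derivative_zero_constant) auto
  then obtain c where c: "w x * exp (- A x) = c" if "x \<in> {0..1}" for x by blast
  have w_eq: "w x = w 0 * exp (A x)" if "x \<in> {0..1}" for x
    using c[OF that] c[of 0] by (simp add: A_def exp_minus field_simps)
  \<comment> \<open>Writing the constant flux through the boundary value at the endpoint in question
    makes \<open>w\<close> factor there.\<close>
  have w0: "w 0 = (1 - v 0) * (v 0 - \<alpha>)"
    unfolding w_def bc[symmetric] by (simp add: algebra_simps)
  have w1: "w 1 = v 1 * (1 - v 1 - \<beta>)"
    unfolding w_def by (simp add: algebra_simps)
  have incr: "v x \<le> v y" if "w 0 \<ge> 0" "0 \<le> x" "x \<le> y" "y \<le> 1" for x y
  proof (rule DERIV_nonneg_imp_increasing_open[OF that(3)])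
    fix z assume z: "x < z" "z < y"
    then have "0 \<le> w z / \<epsilon>" using w_eq[of z] that \<epsilon> by simp
    then show "\<exists>d. (v has_real_derivative d) (at z) \<and> 0 \<le> d"
      using v_interior[of z] z that by fastforce
  next
    show "continuous_on {x..y} v" by (rule continuous_on_subset[OF cv]) (use that in auto)
  qed
  have decr: "v y \<le> v x" if "w 0 \<le> 0" "0 \<le> x" "x \<le> y" "y \<le> 1" for x y
  proof (rule DERIV_nonpos_imp_decreasing_open[OF that(3)])
    fix z assume z: "x < z" "z < y"
    then have "w z / \<epsilon> \<le> 0" using w_eq[of z] that \<epsilon> by (simp add: divide_nonpos_pos mult_nonpos_nonneg)
    then show "\<exists>d. (v has_real_derivative d) (at z) \<and> d \<le> 0"
      using v_interior[of z] z that by fastforce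
  next
    show "continuous_on {x..y} v" by (rule continuous_on_subset[OF cv]) (use that in auto)
  qed
  have \<beta>: "\<beta> > 0" using \<alpha> by linarith
  have bounds: "\<alpha> \<le> v 0 \<and> v 1 \<le> 1 - \<beta> \<and> w 0 \<ge> 0"
  proof -
    consider "w 0 > 0" | "w 0 = 0" | "w 0 < 0" by linarith
    then show ?thesis
    proof cases
      case 1
      then have v0: "\<alpha> < v 0" "v 0 < 1" using w0 \<alpha> by (auto simp: zero_less_mult_iff)
      then have "0 < v 1" using incr[of 0 1] 1 \<alpha> by simp
      moreover have "0 < w 1" using w_eq[of 1] 1 by simp
      ultimately have "v 1 < 1 - \<beta>" using w1 by (simp add: zero_less_mult_iff)
      with v0 1 show ?thesis by simp
    next
      case 2
      \<comment> \<open>Here \<open>v\<close> is constant. The condition at 0 leaves the values 1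
        and \<open>\<alpha>\<close>, and the condition at 1 rules out 1 because
        \<open>\<beta>\<close> is positive.\<close>
      have v01: "v 1 = v 0" using incr[of 0 1] decr[of 0 1] 2 by simp
      have "v 0 * (1 - v 0 - \<beta>) = 0" using w_eq[of 1] w1 2 v01 by simp
      moreover have "v 0 = 1 \<or> v 0 = \<alpha>" using w0 2 by auto
      ultimately have "v 0 = \<alpha>" using \<beta> by auto
      then show ?thesis using v01 2 \<alpha> by simp
    next
      case 3
      have w1': "w 1 < 0" using w_eq[of 1] 3 by (simp add: mult_neg_pos)
      have "v 0 > 1 \<or> v 0 < \<alpha>" using w0 3 by (auto simp: mult_less_0_iff)
      then show ?thesis
      proof
        assume v0: "v 0 > 1"
        then have J: "\<beta> * v 1 \<le> 0" using \<alpha> unfolding bc[symmetric] by (simp add: mult_nonneg_nonpos)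
        then have "v 1 \<le> 0" using \<beta> by (simp add: mult_le_0_iff)
        \<comment> \<open>Falling from above 1 to at most 0, \<open>v\<close> crosses 1/2, where
          \<open>w\<close> is 1/4 minus a nonpositive flux, contradicting the negative sign of
          \<open>w\<close>.\<close>
        then obtain x where x: "x \<in> {0..1}" "v x = 1 / 2"
          using IVT2'[of v 1 "1/2" 0] v0 cv by auto
        then have "w x > 0" unfolding w_def x(2) using J by simp
        then show ?thesis using w_eq[OF x(1)] 3 by (simp add: zero_less_mult_iff)
      next
        assume v0: "v 0 < \<alpha>"
        then have "v 1 < \<alpha>" using decr[of 0 1] 3 by simp
        \<comment> \<open>The factor \<open>1 - v 1 - \<beta>\<close> is positive because
          \<open>\<alpha> + \<beta> < 1\<close>, so the other factor of \<open>w 1\<close> is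
          negative. The flux would then be negative at 1 but nonnegative at 0.\<close>
        then have "v 1 < 0" using w1 w1' \<alpha> by (auto simp: mult_less_0_iff)
        then have "\<beta> * v 1 < 0" using \<beta> by (simp add: mult_pos_neg)
        moreover have "\<alpha> * (1 - v 0) \<ge> 0" using v0 \<alpha> by simp
        ultimately show ?thesis using bc by simp
      qed
    qed
  qed
  have range: "\<alpha> \<le> v x" "v x \<le> 1 - \<beta>" if "x \<in> {0..1}" for x
    using incr[of 0 x] incr[of x 1] bounds that by auto
  have key: "(\<beta> - \<alpha>) * \<bar>v x - \<alpha>\<bar> \<le> w x" if "x \<in> {0..1}" for x
  proof -
    have "(v x - \<alpha>) * (\<beta> - \<alpha>) \<le> (v x - \<alpha>) * (1 - v x - \<alpha>)"
      using range[OF that] by (intro mult_left_mono) auto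
    \<comment> \<open>Obtained by splitting the flux \<open>\<alpha> * (1 - v 0)\<close> as
      \<open>\<alpha> * (1 - \<alpha>) - \<alpha> * (v 0 - \<alpha>)\<close>; the excess term has a
      favourable sign.\<close>
    moreover have "w x = (v x - \<alpha>) * (1 - v x - \<alpha>) + \<alpha> * (v 0 - \<alpha>)"
      unfolding w_def bc[symmetric] by (simp add: algebra_simps)
    moreover have "0 \<le> \<alpha> * (v 0 - \<alpha>)" using bounds \<alpha> by simp
    ultimately show ?thesis using range[OF that] by (simp add: mult.commute)
  qed
  have "((\<lambda>x. w x / \<epsilon>) has_integral v 1 - v 0) {0..1}"
    by (rule fundamental_theorem_of_calculus)
      (use ode in \<open>auto simp: w_def has_real_derivative_iff_has_vector_derivative[symmetric]\<close>)
  then have wi: "(w has_integral \<epsilon> * (v 1 - v 0)) {0..1}"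
    using has_integral_mult_right[of "\<lambda>x. w x / \<epsilon>" _ _ \<epsilon>] \<epsilon> by fastforce
  have ci: "(\<lambda>x. \<bar>v x - \<alpha>\<bar>) integrable_on {0..1}"
    by (intro integrable_continuous_real continuous_intros cv)
  \<comment> \<open>Integrating \<open>key\<close> leaves only the total increase of
    \<open>v\<close>, which the endpoint bounds control.\<close>
  have "(\<beta> - \<alpha>) * integral {0..1} (\<lambda>x. \<bar>v x - \<alpha>\<bar>) \<le> \<epsilon> * (v 1 - v 0)"
    by (rule has_integral_le[OF has_integral_mult_right[OF integrable_integral[OF ci]] wi])
      (use key in auto)
  also have "\<dots> \<le> \<epsilon> * (1 - \<alpha> - \<beta>)"
    using bounds \<epsilon> by (intro mult_left_mono) auto
  finally show ?thesis using \<alpha> by (simp add: field_simps)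
qed

lemma integral_reflect_unit:
  fixes f :: "real \<Rightarrow> real"
  assumes "continuous_on {0..1} f"
  shows "integral {0..1} (\<lambda>x. f (1 - x)) = integral {0..1} f"
proof -
  have "(f has_integral integral {0..1} f) (cbox 0 1)"
    using assms by (auto intro: integrable_integral integrable_continuous_real)
  from has_integral_affinity[OF this, of "-1" 1]
  have "((\<lambda>x. f (1 - x)) has_integral integral {0..1} f) ((\<lambda>x. 1 - x) ` {0..1})"
    by simp
  moreover have "(\<lambda>x. 1 - x) ` {0..1::real} = {0..1}"
    by (auto intro!: image_eqI[of _ _ "1 - _"])
  ultimately show ?thesis by (simp add: integral_unique)
qed

text \<open>The two sign changes in differentiating \<open>u\<close> cancel,
  \<open>v * (1 - v)\<close> is invariant under v -> 1 - v, and \<open>\<alpha> * u 1\<close> equals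
  the old flux \<open>\<beta> * v 1\<close>. Hence \<open>u\<close> solves the problem with
  \<open>\<alpha>\<close> and \<open>\<beta>\<close> exchanged.\<close>

lemma ode_bound_reflected:
  fixes v :: "real \<Rightarrow> real"
  assumes \<epsilon>: "\<epsilon> > 0" and \<beta>: "0 \<le> \<beta>" "\<beta> < \<alpha>" "\<alpha> < 1 / 2"
    and bc: "\<alpha> * (1 - v 0) = \<beta> * v 1"
    and ode: "\<And>x. x \<in> {0..1} \<Longrightarrow>
      (v has_real_derivative (v x * (1 - v x) - \<beta> * v 1) / \<epsilon>) (at x within {0..1})"
  shows "integral {0..1} (\<lambda>x. \<bar>v x - 1 + \<beta>\<bar>) \<le> \<epsilon> * ((1 - \<alpha> - \<beta>) / (\<alpha> - \<beta>))"
proof -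
  define u where "u x = 1 - v (1 - x)" for x
  have cv: "continuous_on {0..1} v"
    using ode by (meson DERIV_continuous continuous_on_eq_continuous_within)
  have "integral {0..1} (\<lambda>x. \<bar>u x - \<beta>\<bar>) \<le> \<epsilon> * ((1 - \<beta> - \<alpha>) / (\<alpha> - \<beta>))"
  proof (rule ode_bound[OF \<epsilon> \<beta>])
    show "\<beta> * (1 - u 0) = \<alpha> * u 1" using bc by (simp add: u_def)
    fix x :: real assume x: "x \<in> {0..1}"
    \<comment> \<open>The chain rule asks for the derivative of \<open>v\<close> within the
      reflected interval, which lies in [0,1].\<close>
    have img: "(\<lambda>x. 1 - x) ` {0..1::real} \<subseteq> {0..1}" by auto
    have "(v has_real_derivative (v (1 - x) * (1 - v (1 - x)) - \<beta> * v 1) / \<epsilon>)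
        (at (1 - x) within (\<lambda>x. 1 - x) ` {0..1})"
      by (rule has_field_derivative_subset[OF ode img]) (use x in auto)
    moreover have "((\<lambda>x. 1 - x) has_real_derivative - 1) (at x within {0..1})"
      by (auto intro!: derivative_eq_intros)
    ultimately have "((\<lambda>x. v (1 - x)) has_real_derivative
        (v (1 - x) * (1 - v (1 - x)) - \<beta> * v 1) / \<epsilon> * - 1) (at x within {0..1})"
      using DERIV_image_chain[of v _ "\<lambda>x. 1 - x" x "{0..1}" "- 1"] by (simp add: o_def)
    from DERIV_diff[OF DERIV_const[of 1] this]
    have "(u has_real_derivative 0 - (v (1 - x) * (1 - v (1 - x)) - \<beta> * v 1) / \<epsilon> * - 1)
        (at x within {0..1})"
      by (simp only: u_def[abs_def])
    moreover have J: "\<alpha> * u 1 = \<beta> * v 1" using bc by (simp add: u_def)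
    have "0 - (v (1 - x) * (1 - v (1 - x)) - \<beta> * v 1) / \<epsilon> * - 1 =
        (u x * (1 - u x) - \<alpha> * u 1) / \<epsilon>"
      unfolding J using \<epsilon> by (simp add: u_def field_simps)
    ultimately show "(u has_real_derivative (u x * (1 - u x) - \<alpha> * u 1) / \<epsilon>) (at x within {0..1})"
      by (rule DERIV_cong)
  qed
  moreover have "\<bar>u x - \<beta>\<bar> = (\<lambda>y. \<bar>v y - 1 + \<beta>\<bar>) (1 - x)" for x
    unfolding u_def by arith
  moreover have "integral {0..1} (\<lambda>x. (\<lambda>y. \<bar>v y - 1 + \<beta>\<bar>) (1 - x)) = integral {0..1} (\<lambda>y. \<bar>v y - 1 + \<beta>\<bar>)"
    by (rule integral_reflect_unit) (intro continuous_intros cv)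
  ultimately show ?thesis by (simp add: algebra_simps)
qed

theorem theorem4p4:
  fixes \<epsilon> \<alpha> \<beta> :: real and \<rho> :: "real \<Rightarrow> real"
  assumes "\<epsilon> > 0"
    and "\<alpha> \<in> {0..1}" and "\<beta> \<in> {0..1}"
    and "max \<alpha> \<beta> < 1 / 2"
    and "weak_solution \<epsilon> \<alpha> \<beta> \<rho>"
  shows "(\<alpha> < \<beta> \<longrightarrow>
            (\<integral>x. \<bar>\<rho> x - \<alpha>\<bar> \<partial>unit_meas) \<le> \<epsilon> * ((1 - \<alpha> - \<beta>) / (\<beta> - \<alpha>)))
       \<and> (\<alpha> > \<beta> \<longrightarrow>
            (\<integral>x. \<bar>\<rho> x - 1 + \<beta>\<bar> \<partial>unit_meas) \<le> \<epsilon> * ((1 - \<alpha> - \<beta>) / (\<alpha> - \<beta>)))"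
proof -
  define v where "v = cont_rep \<rho>"
  have H1: "\<rho> \<in> H1" using assms(5) by (simp add: weak_solution_def)
  have \<rho>_meas: "\<rho> \<in> borel_measurable unit_meas" using H1 by (simp add: H1_def L2_def)
  have cv: "continuous_on {0..1} v" unfolding v_def by (rule cont_rep_props(1)[OF H1])
  \<comment> \<open>Transfers the claim from the arbitrary representative \<open>\<rho>\<close> to
    \<open>v\<close>, and from the Bochner to the gauge integral.\<close>
  have eq: "(\<integral>x. \<bar>\<rho> x - c\<bar> \<partial>unit_meas) = integral {0..1} (\<lambda>x. \<bar>v x - c\<bar>)" for c
  proof -
    have int: "integrable unit_meas (\<lambda>x. \<bar>v x - c\<bar>)"
      by (intro continuous_integrable_unit(1) continuous_intros cv)
    have "(\<integral>x. \<bar>\<rho> x - c\<bar> \<partial>unit_meas) = (\<integral>x. \<bar>v x - c\<bar> \<partial>unit_meas)"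
    proof (rule integral_cong_AE)
      show "AE x in unit_meas. \<bar>\<rho> x - c\<bar> = \<bar>v x - c\<bar>"
        using cont_rep_props(2)[OF H1] by eventually_elim (simp add: v_def)
    qed (use \<rho>_meas int in auto)
    then show ?thesis using integral_unit[OF int] by simp
  qed
  have bc: "\<alpha> * (1 - v 0) = \<beta> * v 1"
    unfolding v_def by (rule weak_solution_flux(1)[OF assms(5)])
  note ode = weak_solution_ode[OF assms(5,1), folded v_def]
  show ?thesis
  proof (intro conjI impI)
    assume "\<alpha> < \<beta>"
    then show "(\<integral>x. \<bar>\<rho> x - \<alpha>\<bar> \<partial>unit_meas) \<le> \<epsilon> * ((1 - \<alpha> - \<beta>) / (\<beta> - \<alpha>))"
      unfolding eq using assms by (intro ode_bound bc ode) auto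
  next
    assume "\<alpha> > \<beta>"
    then have "integral {0..1} (\<lambda>x. \<bar>v x - 1 + \<beta>\<bar>) \<le> \<epsilon> * ((1 - \<alpha> - \<beta>) / (\<alpha> - \<beta>))"
      using assms by (intro ode_bound_reflected bc ode) auto
    \<comment> \<open>The transfer is used with the constant \<open>1 - \<beta>\<close>, the bulk
      value in this case.\<close>
    then show "(\<integral>x. \<bar>\<rho> x - 1 + \<beta>\<bar> \<partial>unit_meas) \<le> \<epsilon> * ((1 - \<alpha> - \<beta>) / (\<alpha> - \<beta>))"
      using eq[of "1 - \<beta>"] by (simp add: algebra_simps)
  qed
qed

end
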